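(* There exist three sequences $\{G_1(n)\}_{n>0}$, $\{G_2(n)\}_{n>0}$, $\{G_3(n)\}_{n>0}$ of finite simple graphs with independence number three, such that for every $n$, writing the independence polynomial as $1+a_1z+a_2z^2+a_3z^3$, $G_1(n)$ satisfies $a_2^2<3a_1a_3$, $G_2(n)$ satisfies $a_2^2=3a_1a_3$, and $G_3(n)$ satisfies $a_2^2>3a_1a_3$, and such that $\operatorname{diam}(\mathcal{A}(G_i(n)))\to\infty$ as $n\to\infty$ for each $i=1,2,3$.
   Context: An independent set in a simple graph $G$ is a set of pairwise non-adjacent vertices; the independence number is the largest size of an independent set. The independence polynomial is $I_G(z)=\sum_{i=0}^{d}a_iz^i$ with $a_0=1$, where $a_i$ is the number of independent sets with exactly $i$ elements and $d$ is the independence number. The lexicographic product of $G$ with itself has vertex set $V(G)\times V(G)$, with $(a,x)$ adjacent to $(b,y)$ iff $a$ is adjacent to $b$ in $G$, or $a=b$ and $x$ is adjacent to $y$ in $G$; $G^m$ denotes the $m$-fold lexicographic product. For a polynomial $f$, $\mathrm{Roots}(f)=\{z: f(z)=0\}$. The independence attractor is $\mathcal{A}(G)=\lim_{m\to\infty}\mathrm{Roots}(I_{G^m})$ in the Hausdorff metric on compact subsets of $\mathbb{C}$. The diameter of $A\subset\mathbb{C}$ is $\sup\{|z-w|:z,w\in A\}$. *)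

theory Defs
  imports
    "HOL-Analysis.Analysis"
    "HOL-Computational_Algebra.Polynomial"
    "Graph_Theory.Graph_Theory"
begin

text \<open>Finite simple graphs are the instances of the locale \<open>pair_graph\<close>: finitely many vertices
  and a symmetric, loop-free set of arcs, an edge \<open>uv\<close> being the pair of arcs \<open>(u, v)\<close>, \<open>(v, u)\<close>.\<close>

text \<open>There is no need to ask for \<open>u \<noteq> v\<close> below, as the graphs have no loops.\<close>

definition independent_set :: "'a pair_pre_digraph \<Rightarrow> 'a set \<Rightarrow> bool" where
  "independent_set G S \<longleftrightarrow> S \<subseteq> pverts G \<and> (\<forall>u\<in>S. \<forall>v\<in>S. (u, v) \<notin> parcs G)"

definition indep_number :: "'a pair_pre_digraph \<Rightarrow> nat" where
  "indep_number G = Max (card ` {S. independent_set G S})"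

definition indep_count :: "'a pair_pre_digraph \<Rightarrow> nat \<Rightarrow> nat" where
  "indep_count G i = card {S. independent_set G S \<and> card S = i}"

definition indep_poly :: "'a pair_pre_digraph \<Rightarrow> complex poly" where
  "indep_poly G = (\<Sum>i\<le>indep_number G. monom (of_nat (indep_count G i)) i)"

lemma indep_count_0:
  assumes "pair_graph G"
  shows "indep_count G 0 = 1"
proof -
  interpret pair_graph G by fact
  have "{S. independent_set G S \<and> card S = 0} = {{}}"
    using pair_finite_verts by (auto simp: independent_set_def dest: finite_subset)
  then show ?thesis by (simp add: indep_count_def)
qed

lemma indep_poly_indep_number_3:
  assumes "pair_graph G" "indep_number G = 3"
  shows "indep_poly G = [:1, of_nat (indep_count G 1), of_nat (indep_count G 2),
                          of_nat (indep_count G 3):]"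
  using indep_count_0[OF assms(1)]
  by (simp add: indep_poly_def assms(2) numeral_eq_Suc monom_Suc monom_0)

definition lex_prod :: "'a pair_pre_digraph \<Rightarrow> 'b pair_pre_digraph \<Rightarrow> ('a \<times> 'b) pair_pre_digraph" where
  "lex_prod G H =
     \<lparr> pverts = pverts G \<times> pverts H,
       parcs = {((a, x), (b, y)) | a x b y.
          a \<in> pverts G \<and> x \<in> pverts H \<and> b \<in> pverts G \<and> y \<in> pverts H \<and>
          ((a, b) \<in> parcs G \<or> a = b \<and> (x, y) \<in> parcs H)} \<rparr>"

text \<open>The nested pairs in the vertex set of the \<open>m\<close>-fold product have a type depending on \<open>m\<close>, so
  the vertex \<open>(x\<^sub>1, (x\<^sub>2, \<dots>))\<close> is relabelled to the list \<open>[x\<^sub>1, x\<^sub>2, \<dots>]\<close>. The recursion starts from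
  the one-vertex graph, a unit of the product up to isomorphism.\<close>

primrec lex_power :: "'a pair_pre_digraph \<Rightarrow> nat \<Rightarrow> 'a list pair_pre_digraph" where
  "lex_power G 0 = \<lparr> pverts = {[]}, parcs = {} \<rparr>"
| "lex_power G (Suc m) =
     (let P = lex_prod G (lex_power G m); cons = (\<lambda>(x, xs). x # xs)
      in \<lparr> pverts = cons ` pverts P, parcs = map_prod cons cons ` parcs P \<rparr>)"

definition Roots :: "complex poly \<Rightarrow> complex set" where
  "Roots p = {z. poly p z = 0}"

text \<open>Only meaningful for nonempty compact arguments, where the suprema are those of nonempty
  bounded sets.\<close>

definition hausdorff_dist :: "'a::metric_space set \<Rightarrow> 'a set \<Rightarrow> real" where
  "hausdorff_dist A B = max (SUP x\<in>A. infdist x B) (SUP y\<in>B. infdist y A)"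

definition hausdorff_limit :: "(nat \<Rightarrow> 'a::metric_space set) \<Rightarrow> 'a set \<Rightarrow> bool" where
  "hausdorff_limit X A \<longleftrightarrow>
     compact A \<and> A \<noteq> {} \<and> (\<forall>\<^sub>F m in sequentially. compact (X m) \<and> X m \<noteq> {}) \<and>
     (\<lambda>m. hausdorff_dist (X m) A) \<longlonglongrightarrow> 0"

lemma infdist_le_hausdorff_dist:
  fixes A B :: "'a::metric_space set"
  assumes "compact A" "compact B"
  shows "x \<in> A \<Longrightarrow> infdist x B \<le> hausdorff_dist A B"
    and "y \<in> B \<Longrightarrow> infdist y A \<le> hausdorff_dist A B"
proof -
  have bdd: "bdd_above ((\<lambda>x. infdist x T) ` S)" if "compact S" for S T :: "'a set"
    using that by (intro bounded_imp_bdd_above compact_imp_bounded compact_continuous_image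
        continuous_intros)
  show "x \<in> A \<Longrightarrow> infdist x B \<le> hausdorff_dist A B"
    unfolding hausdorff_dist_def by (intro max.coboundedI1 cSUP_upper bdd assms)
  show "y \<in> B \<Longrightarrow> infdist y A \<le> hausdorff_dist A B"
    unfolding hausdorff_dist_def by (intro max.coboundedI2 cSUP_upper bdd assms)
qed

lemma hausdorff_limit_subset:
  fixes A B :: "'a::heine_borel set"
  assumes A: "hausdorff_limit X A" and B: "hausdorff_limit X B"
  shows "A \<subseteq> B"
proof
  fix x assume x: "x \<in> A"
  have cpt: "compact A" "compact B" "B \<noteq> {}"
    and lim: "(\<lambda>m. hausdorff_dist (X m) A) \<longlonglongrightarrow> 0" "(\<lambda>m. hausdorff_dist (X m) B) \<longlonglongrightarrow> 0"
    and ev: "\<forall>\<^sub>F m in sequentially. compact (X m) \<and> X m \<noteq> {}"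
    using A B by (auto simp: hausdorff_limit_def)
  have "\<forall>\<^sub>F m in sequentially. infdist x B \<le> hausdorff_dist (X m) A + hausdorff_dist (X m) B"
    using ev
  proof eventually_elim
    case (elim m)
    then obtain r where r: "r \<in> X m" "infdist x (X m) = dist x r"
      using infdist_attains_inf[of "X m" x] compact_imp_closed by metis
    have "infdist x B \<le> infdist r B + dist x r"
      by (rule infdist_triangle)
    also have "\<dots> \<le> hausdorff_dist (X m) B + hausdorff_dist (X m) A"
      using infdist_le_hausdorff_dist[of "X m" B] infdist_le_hausdorff_dist[of "X m" A]
        elim cpt r x by (intro add_mono) (metis, metis)
    finally show ?case by simp
  qed
  then have "infdist x B \<le> 0 + 0"
    by (intro tendsto_lowerbound[OF tendsto_add[OF lim]]) auto
  then show "x \<in> B"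
    using cpt in_closed_iff_infdist_zero[of B x] infdist_nonneg[of x B] compact_imp_closed
    by auto
qed

lemma hausdorff_limit_unique:
  fixes A B :: "'a::heine_borel set"
  shows "hausdorff_limit X A \<Longrightarrow> hausdorff_limit X B \<Longrightarrow> A = B"
  using hausdorff_limit_subset by blast

definition has_independence_attractor :: "'a pair_pre_digraph \<Rightarrow> complex set \<Rightarrow> bool" where
  "has_independence_attractor G A \<longleftrightarrow> hausdorff_limit (\<lambda>m. Roots (indep_poly (lex_power G m))) A"

definition independence_attractor :: "'a pair_pre_digraph \<Rightarrow> complex set" where
  "independence_attractor G = (THE A. has_independence_attractor G A)"

lemma independence_attractor_eq:
  "has_independence_attractor G A \<Longrightarrow> independence_attractor G = A"
  unfolding independence_attractor_def has_independence_attractor_def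
  by (rule the_equality) (assumption, rule hausdorff_limit_unique)

end

theory Submission
  imports Defs "HOL-Computational_Algebra.Fundamental_Theorem_Algebra"
begin

text \<open>With \<open>P = I\<^sub>G - 1\<close> one has \<open>I\<^bsub>G\<^sup>m\<^esub> = 1 + P\<^sup>m\<close> (the \<open>m\<close>-th iterate), so that the attractor is the limit
  of the preimages \<open>P\<^sup>-\<^sup>m(-1)\<close>. If \<open>P\<close> is strongly expanding on the preimage of a disc containing its own
  preimage and the point \<open>-1\<close>, then pulling back contracts distances, and these preimages converge to
  the set of points whose orbit stays in the disc, which contains \<open>0\<close> and all the roots of \<open>P\<close>.
  The polynomials \<open>P(z) = z\<^sup>3 + s k z\<^sup>2 + t k\<^sup>2 z = k\<^sup>3 Q(z / k)\<close> with \<open>Q(w) = w\<^sup>3 + s w\<^sup>2 + t w\<close> without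
  multiple roots have this property on the disc of radius \<open>4 k\<close> for large \<open>k\<close>, since there \<open>Q\<close> is small
  on the preimage, \<open>Q'\<close> is bounded below and \<open>P'(z) = k\<^sup>2 Q'(z / k)\<close>; their roots spread out linearly in
  \<open>k\<close>. The pairs \<open>(s, t) = (1, 1), (3, 3), (3, 2)\<close> give the three signs of \<open>a\<^sub>2\<^sup>2 - 3 a\<^sub>1 a\<^sub>3\<close>.\<close>

section \<open>Preimages under expanding polynomials\<close>

lemma poly_pderiv_prod_linear:
  fixes r :: "nat \<Rightarrow> 'a::field"
  assumes "\<And>i. i < n \<Longrightarrow> z \<noteq> r i"
  shows "poly (pderiv (\<Prod>i<n. [:- r i, 1:])) z =
    poly (\<Prod>i<n. [:- r i, 1:]) z * (\<Sum>i<n. 1 / (z - r i))"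
  using assms
proof (induction n)
  case (Suc n)
  have "z - r n \<noteq> 0"
    using Suc.prems[of n] by simp
  moreover have "pderiv [:- r n, 1:] = 1"
    by (simp add: pderiv_pCons)
  ultimately show ?case
    using Suc by (simp add: pderiv_mult field_simps del: mult_pCons_left mult_pCons_right)
qed simp

text \<open>The logarithmic derivative at \<open>z\<close> is the sum of the \<open>1 / (z - r)\<close> over the roots, so that one of
  these terms is at least the average in modulus.\<close>

lemma poly_root_near:
  fixes p :: "complex poly"
  assumes "poly (pderiv p) z \<noteq> 0"
  obtains r where "poly p r = 0"
    "cmod (z - r) \<le> degree p * cmod (poly p z) / cmod (poly (pderiv p) z)"
proof (cases "poly p z = 0")
  case True
  then show ?thesis
    using that[of z] by simp
next
  case False
  define n where "n = degree p"
  define B where "B = n * cmod (poly p z) / cmod (poly (pderiv p) z)"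
  obtain r where r: "smult (lead_coeff p) (\<Prod>i<n. [:- r i, 1:]) = p"
    unfolding n_def by (rule complex_poly_decompose')
  have root: "poly p (r i) = 0" if "i < n" for i
    using that by (subst r[symmetric]) (auto simp: poly_prod)
  have n: "n > 0"
    using assms by (metis n_def gr0I pderiv_eq_0_iff poly_0)
  have B: "B > 0"
    using n assms False by (simp add: B_def)
  have "\<exists>i<n. cmod (z - r i) \<le> B"
  proof (rule ccontr)
    assume "\<not> ?thesis"
    then have far: "B < cmod (z - r i)" if "i < n" for i
      using that by force
    have "poly (pderiv p) z = poly p z * (\<Sum>i<n. 1 / (z - r i))"
    proof -
      have "poly (pderiv (\<Prod>i<n. [:- r i, 1:])) z =
          poly (\<Prod>i<n. [:- r i, 1:]) z * (\<Sum>i<n. 1 / (z - r i))"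
        using False root by (intro poly_pderiv_prod_linear) auto
      then show ?thesis
        by (subst (1 2) r[symmetric]) (simp add: pderiv_smult)
    qed
    then have "cmod (poly (pderiv p) z) = cmod (poly p z) * cmod (\<Sum>i<n. 1 / (z - r i))"
      by (simp add: norm_mult)
    also have "cmod (\<Sum>i<n. 1 / (z - r i)) \<le> (\<Sum>i<n. 1 / cmod (z - r i))"
      by (rule order.trans[OF norm_sum]) (simp add: norm_divide)
    also have "\<dots> < (\<Sum>i<n. 1 / B)"
    proof (intro sum_strict_mono)
      show "1 / cmod (z - r i) < 1 / B" if "i \<in> {..<n}" for i
        using far[of i] that B by (intro divide_strict_left_mono mult_pos_pos) auto
    qed (use n in auto)
    also have "cmod (poly p z) * \<dots> = cmod (poly (pderiv p) z)"
      using n assms False by (simp add: B_def)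
    finally show False
      using False by simp
  qed
  then show ?thesis
    using that root unfolding B_def n_def by blast
qed

text \<open>\<open>bound\<close> places the preimage of the closed disc of radius \<open>R\<close>
  inside that disc. The \<open>degree p\<close> in \<open>expanding\<close> offsets the factor lost
  in \<open>poly_root_near\<close>, and the 2 leaves a contraction by one half under pulling
  back.\<close>

locale expanding_poly =
  fixes p :: "complex poly" and R :: real
  assumes poly_0: "poly p 0 = 0"
    and bound: "cmod (poly p z) \<le> R \<Longrightarrow> cmod z \<le> R"
    and degree_pos: "0 < degree p"
    and expanding: "cmod (poly p z) \<le> R \<Longrightarrow> 2 * degree p \<le> cmod (poly (pderiv p) z)"
    and R_nonneg: "0 \<le> R"
begin

definition filled_julia :: "complex set" where
  "filled_julia = {z. \<forall>m. cmod ((poly p ^^ m) z) \<le> R}"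

text \<open>By contraposition, an orbit that starts outside the disc never enters it. Control at
  time \<open>m\<close> is therefore control at all earlier times.\<close>

lemma iterate_bound: "cmod ((poly p ^^ m) z) \<le> R \<Longrightarrow> cmod z \<le> R"
  by (induction m) (auto dest: bound)

lemma iterate_0: "(poly p ^^ m) 0 = 0"
  by (induction m) (auto simp: poly_0)

lemma continuous_on_iterate: "continuous_on A (poly p ^^ m)"
proof (induction m)
  case (Suc m)
  then show ?case
    using continuous_on_poly[OF Suc, of p] by (simp add: o_def)
qed auto

text \<open>A preimage of \<open>v\<close> is a root of \<open>p - [:v:]\<close>, which has the same
  derivative as \<open>p\<close>, so \<open>poly_root_near\<close> finds one close to
  \<open>z\<close>.\<close>

lemma pullback_step:
  assumes "cmod (poly p z) \<le> R"
  shows "\<exists>y. poly p y = v \<and> cmod (z - y) \<le> cmod (poly p z - v) / 2"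
proof -
  let ?q = "p - [:v:]" and ?d = "cmod (poly (pderiv p) z)"
  have d: "2 * degree p \<le> ?d" "0 < degree p"
    using expanding[OF assms] degree_pos by auto
  have q: "pderiv ?q = pderiv p" "degree ?q = degree p"
    using d(2) degree_add_eq_left[of "- [:v:]" p]
    by (auto simp: pderiv_add pderiv_pCons diff_conv_add_uminus simp del: add_uminus_conv_diff)
  have "poly (pderiv ?q) z \<noteq> 0"
    using d q by auto
  then obtain y where y: "poly ?q y = 0" "cmod (z - y) \<le> degree ?q * cmod (poly ?q z) / ?d"
    unfolding q(1)[symmetric] by (rule poly_root_near)
  have "cmod (z - y) \<le> degree p * cmod (poly p z - v) / ?d"
    using y(2) q by simp
  also have "\<dots> \<le> degree p * cmod (poly p z - v) / (2 * degree p)"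
    using d by (intro divide_left_mono mult_pos_pos) auto
  also have "\<dots> = cmod (poly p z - v) / 2"
    using d(2) by simp
  finally show ?thesis
    using y(1) by (intro exI[of _ y]) auto
qed

text \<open>The target \<open>v\<close> is pulled back along the orbit of \<open>z\<close>, from its
  last point to its first. \<open>bound\<close> keeps the intermediate targets in the disc, and each
  step halves the distance.\<close>

lemma pullback:
  assumes "cmod ((poly p ^^ m) z) \<le> R" "cmod v \<le> R"
  shows "\<exists>y. (poly p ^^ m) y = v \<and> cmod (z - y) \<le> cmod ((poly p ^^ m) z - v) / 2 ^ m"
  using assms
proof (induction m arbitrary: v)
  case (Suc m)
  let ?u = "(poly p ^^ m) z"
  from Suc.prems pullback_step[of ?u v]
  obtain w where w: "poly p w = v" "cmod (?u - w) \<le> cmod (poly p ?u - v) / 2"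
    by auto
  have "cmod ?u \<le> R" "cmod w \<le> R"
    using Suc.prems w by (auto intro: bound)
  with Suc.IH[of w] obtain y where y: "(poly p ^^ m) y = w" "cmod (z - y) \<le> cmod (?u - w) / 2 ^ m"
    by auto
  have "cmod (?u - w) / 2 ^ m \<le> cmod (poly p ?u - v) / 2 / 2 ^ m"
    using w by (intro divide_right_mono) auto
  with w y show ?case
    by (intro exI[of _ y]) auto
qed auto

lemma compact_filled_julia: "compact filled_julia"
proof -
  have "filled_julia = (\<Inter>m. (poly p ^^ m) -` cball 0 R)"
    by (auto simp: filled_julia_def)
  moreover have "closed ((poly p ^^ m) -` cball 0 R)" for m
    by (intro closed_vimage closed_cball continuous_on_iterate)
  ultimately have "closed filled_julia"
    by auto
  moreover have "bounded filled_julia"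
    unfolding bounded_iff filled_julia_def by (auto intro!: exI[of _ R] dest: spec[of _ 0])
  ultimately show ?thesis
    by (simp add: compact_eq_bounded_closed)
qed

text \<open>Up to time \<open>m\<close> the iterates are preimages of 0, held in the disc by
  \<open>iterate_bound\<close>; afterwards the orbit rests at the fixed point 0.\<close>

lemma iterate_0_in_filled_julia:
  assumes "(poly p ^^ m) z = 0"
  shows "z \<in> filled_julia"
  unfolding filled_julia_def
proof safe
  fix k
  show "cmod ((poly p ^^ k) z) \<le> R"
  proof (cases "k \<le> m")
    case True
    then have "(poly p ^^ (m - k)) ((poly p ^^ k) z) = 0"
      using assms funpow_add[of "m - k" k "poly p"] by simp
    then show ?thesis
      using R_nonneg by (simp add: iterate_bound[of "m - k"])
  next
    case False
    then have "(poly p ^^ k) z = (poly p ^^ (k - m)) ((poly p ^^ m) z)"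
      using funpow_add[of "k - m" m "poly p"] by simp
    then show ?thesis
      using assms R_nonneg by (simp add: iterate_0)
  qed
qed

text \<open>A solution for \<open>v\<close> is moved to an \<open>m\<close>-th preimage of 0, which
  lies in \<open>filled_julia\<close>; a point of \<open>filled_julia\<close> is moved to a solution
  for \<open>v\<close>. By \<open>pullback\<close>, both moves have length at most
  \<open>2 * R / 2 ^ m\<close>.\<close>

theorem hausdorff_limit_preimages:
  assumes v: "cmod v \<le> R"
  shows "hausdorff_limit (\<lambda>m. {z. (poly p ^^ m) z = v}) filled_julia"
proof -
  let ?S = "\<lambda>m. {z. (poly p ^^ m) z = v}"
  \<comment> \<open>The orbit of the fixed point 0 stays in the disc, so every target in the disc
    can be pulled back along it.\<close>
  have nonempty: "?S m \<noteq> {}" for m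
    using pullback[of m 0 v] v R_nonneg by (auto simp: iterate_0)
  have 0: "0 \<in> filled_julia"
    using iterate_0_in_filled_julia[of 0 0] by simp
  have "closed (?S m)" for m
    using continuous_closed_preimage_constant[OF continuous_on_iterate closed_UNIV, of m v] by simp
  moreover have "bounded (?S m)" for m
    unfolding bounded_iff using iterate_bound v by (auto intro!: exI[of _ R])
  ultimately have compact: "compact (?S m)" for m
    by (simp add: compact_eq_bounded_closed)
  have upper: "hausdorff_dist (?S m) filled_julia \<le> 2 * R / 2 ^ m" for m
    unfolding hausdorff_dist_def
  proof (intro max.boundedI cSUP_least)
    fix s assume "s \<in> ?S m"
    then obtain t where t: "(poly p ^^ m) t = 0" "cmod (s - t) \<le> cmod v / 2 ^ m"
      using pullback[of m s 0] v R_nonneg by auto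
    have "infdist s filled_julia \<le> dist s t"
      by (intro infdist_le iterate_0_in_filled_julia[OF t(1)])
    also have "\<dots> \<le> cmod v / 2 ^ m"
      using t by (simp add: dist_norm)
    also have "\<dots> \<le> 2 * R / 2 ^ m"
      using v R_nonneg by (intro divide_right_mono) auto
    finally show "infdist s filled_julia \<le> 2 * R / 2 ^ m" .
  next
    fix t assume "t \<in> filled_julia"
    then have t: "cmod ((poly p ^^ m) t) \<le> R"
      by (simp add: filled_julia_def)
    then obtain s where s: "s \<in> ?S m" "cmod (t - s) \<le> cmod ((poly p ^^ m) t - v) / 2 ^ m"
      using pullback[of m t v] v by auto
    have "infdist t (?S m) \<le> dist t s"
      by (intro infdist_le s)
    also have "\<dots> \<le> cmod ((poly p ^^ m) t - v) / 2 ^ m"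
      using s by (simp add: dist_norm)
    also have "\<dots> \<le> 2 * R / 2 ^ m"
      using v t norm_triangle_ineq4[of "(poly p ^^ m) t" v] by (intro divide_right_mono) auto
    finally show "infdist t (?S m) \<le> 2 * R / 2 ^ m" .
  qed (use nonempty 0 in auto)
  have lower: "0 \<le> hausdorff_dist (?S m) filled_julia" for m
    using infdist_le_hausdorff_dist(2)[OF compact compact_filled_julia 0, of m]
    by (meson infdist_nonneg order.trans)
  have "(\<lambda>m. 2 * R / 2 ^ m) \<longlonglongrightarrow> 0"
    by (rule LIMSEQ_divide_realpow_zero) simp
  from tendsto_sandwich[OF _ _ tendsto_const this]
  have "(\<lambda>m. hausdorff_dist (?S m) filled_julia) \<longlonglongrightarrow> 0"
    using upper lower by simp
  then show ?thesis
    unfolding hausdorff_limit_def using compact compact_filled_julia nonempty 0 by auto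
qed

end

section \<open>Independence polynomials of lexicographic powers\<close>

lemma independent_set_subset: "independent_set G S \<Longrightarrow> S \<subseteq> pverts G"
  by (simp add: independent_set_def)

lemma independent_set_empty [simp]: "independent_set G {}"
  by (simp add: independent_set_def)

lemma finite_independent_sets: "finite (pverts G) \<Longrightarrow> finite {S. independent_set G S}"
  by (rule finite_subset[of _ "Pow (pverts G)"]) (auto dest: independent_set_subset)

text \<open>Grouping the independent sets by cardinality. The sum over sets, rather than over sizes,
  is the form that can be expanded for products of graphs.\<close>

lemma poly_indep_poly:
  assumes "finite (pverts G)"
  shows "poly (indep_poly G) z = (\<Sum>S | independent_set G S. z ^ card S)"
proof -
  let ?I = "{S. independent_set G S}"
  have fin: "finite ?I"
    by (rule finite_independent_sets[OF assms])
  have "card ` ?I \<subseteq> {..indep_number G}"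
    unfolding indep_number_def using fin by (auto intro!: Max_ge)
  then have "(\<Sum>S\<in>?I. z ^ card S) =
      (\<Sum>i\<le>indep_number G. \<Sum>S | S \<in> ?I \<and> card S = i. z ^ card S)"
    using fin by (intro sum.group[symmetric]) auto
  also have "\<dots> = (\<Sum>i\<le>indep_number G. of_nat (indep_count G i) * z ^ i)"
    by (intro sum.cong) (auto simp: indep_count_def)
  also have "\<dots> = poly (indep_poly G) z"
    by (simp add: indep_poly_def poly_sum poly_monom)
  finally show ?thesis ..
qed

text \<open>The composition of I_G with I_H - 1: an independent set of the product amounts to its
  projection \<open>T\<close>, independent in \<open>G\<close>, and a nonempty independent set of
  \<open>H\<close> over each vertex of \<open>T\<close>. The power \<open>card T\<close> expands
  into a sum over such choices.\<close>

lemma sum_independent_sets_lex_prod: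
  fixes z :: "'c::comm_ring_1"
  assumes fin: "finite (pverts G)" "finite (pverts H)"
  shows "(\<Sum>S | independent_set (lex_prod G H) S. z ^ card S) =
    (\<Sum>T | independent_set G T. ((\<Sum>U | independent_set H U. z ^ card U) - 1) ^ card T)"
proof -
  let ?I = "{T. independent_set G T}"
  let ?J = "{U. independent_set H U} - {{}}"
  have finT: "finite T" if "T \<in> ?I" for T
    using that fin by (auto dest: independent_set_subset finite_subset)
  have finU: "finite U" if "U \<in> ?J" for U
    using that fin by (auto dest: independent_set_subset finite_subset)
  have finJ: "finite ?J"
    using finite_independent_sets[OF fin(2)] by simp
  \<comment> \<open>Fibres over points of \<open>T\<close> are nonempty; the discarded empty set
    accounts for the 1.\<close>
  have "(\<Sum>U | independent_set H U. z ^ card U) - 1 = (\<Sum>U\<in>?J. z ^ card U)"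
    using finite_independent_sets[OF fin(2)] by (subst sum_diff) auto
  then have "(\<Sum>T\<in>?I. ((\<Sum>U | independent_set H U. z ^ card U) - 1) ^ card T) =
      (\<Sum>T\<in>?I. \<Prod>a\<in>T. \<Sum>U\<in>?J. z ^ card U)"
    by simp
  also have "\<dots> = (\<Sum>T\<in>?I. \<Sum>f\<in>T \<rightarrow>\<^sub>E ?J. \<Prod>a\<in>T. z ^ card (f a))"
    using finT finJ by (intro sum.cong refl prod_sum_PiE) auto
  also have "\<dots> = (\<Sum>T\<in>?I. \<Sum>f\<in>T \<rightarrow>\<^sub>E ?J. z ^ card (Sigma T f))"
  proof (intro sum.cong refl)
    fix T f assume Tf: "T \<in> ?I" "f \<in> T \<rightarrow>\<^sub>E ?J"
    have "card (Sigma T f) = (\<Sum>a\<in>T. card (f a))"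
      using Tf finT finU by (intro card_SigmaI) (auto dest!: PiE_mem)
    then show "(\<Prod>a\<in>T. z ^ card (f a)) = z ^ card (Sigma T f)"
      by (simp add: power_sum)
  qed
  also have "\<dots> = (\<Sum>(T, f)\<in>(SIGMA T:?I. T \<rightarrow>\<^sub>E ?J). z ^ card (Sigma T f))"
    using finT finJ finite_independent_sets[OF fin(1)]
    by (intro sum.Sigma) (auto intro!: finite_PiE)
  also have "\<dots> = (\<Sum>S | independent_set (lex_prod G H) S. z ^ card S)"
  \<comment> \<open>The fibre map is restricted to the projection, so that it is extensional and
    hence determined by \<open>S\<close>.\<close>
  proof (rule sum.reindex_bij_witness[symmetric, where i = "\<lambda>(T, f). Sigma T f"
      and j = "\<lambda>S. (fst ` S, \<lambda>a\<in>fst ` S. S `` {a})"])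
    let ?f = "\<lambda>S. \<lambda>a\<in>fst ` S. S `` {a}"
    fix S assume "S \<in> {S. independent_set (lex_prod G H) S}"
    then have S: "S \<subseteq> pverts G \<times> pverts H"
      and na: "\<And>a x b y. (a, x) \<in> S \<Longrightarrow> (b, y) \<in> S \<Longrightarrow>
        (a, b) \<notin> parcs G \<and> (a = b \<longrightarrow> (x, y) \<notin> parcs H)"
      by (fastforce simp: independent_set_def lex_prod_def)+
    have fst: "a \<in> fst ` S" if "(a, x) \<in> S" for a x
      using that by force
    then have eq: "Sigma (fst ` S) (?f S) = S"
      by auto
    show "(\<lambda>(T, f). Sigma T f) (fst ` S, ?f S) = S"
      using eq by simp
    show "(fst ` S, ?f S) \<in> (SIGMA T:?I. T \<rightarrow>\<^sub>E ?J)"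
    proof (intro SigmaI PiE_I)
      show "fst ` S \<in> ?I"
        using S na by (auto simp: independent_set_def)
      fix a assume "a \<in> fst ` S"
      then show "?f S a \<in> ?J"
        using S na by (auto simp: independent_set_def)
    qed auto
    show "(\<lambda>(T, f). z ^ card (Sigma T f)) (fst ` S, ?f S) = z ^ card S"
      using eq by simp
  next
    fix Tf assume "Tf \<in> (SIGMA T:?I. T \<rightarrow>\<^sub>E ?J)"
    then obtain T f where Tf: "Tf = (T, f)" "independent_set G T" "f \<in> T \<rightarrow>\<^sub>E ?J"
      by auto
    have f: "independent_set H (f a)" "f a \<noteq> {}" if "a \<in> T" for a
      using Tf(3) that by (auto dest: PiE_mem)
    have fst: "fst ` Sigma T f = T"
      using f by force
    moreover have "(\<lambda>a\<in>T. Sigma T f `` {a}) = f"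
      using Tf(3) by (intro ext) (auto simp: restrict_def PiE_def extensional_def)
    ultimately show "(fst ` (case Tf of (T, f) \<Rightarrow> Sigma T f),
        \<lambda>a\<in>fst ` (case Tf of (T, f) \<Rightarrow> Sigma T f). (case Tf of (T, f) \<Rightarrow> Sigma T f) `` {a}) = Tf"
      using Tf by simp
    have "independent_set (lex_prod G H) (Sigma T f)"
      using Tf(2) f by (fastforce simp: independent_set_def lex_prod_def)
    then show "(case Tf of (T, f) \<Rightarrow> Sigma T f) \<in> {S. independent_set (lex_prod G H) S}"
      using Tf by simp
  qed
  finally show ?thesis ..
qed

text \<open>Serves the passage from pairs to lists in \<open>lex_power\<close>.\<close>

lemma independent_sets_relabel:
  assumes "inj f"
  shows "{S. independent_set \<lparr>pverts = f ` pverts G, parcs = map_prod f f ` parcs G\<rparr> S} =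
    (`) f ` {S. independent_set G S}"
proof -
  have "(f x, f y) \<in> map_prod f f ` parcs G \<longleftrightarrow> (x, y) \<in> parcs G" for x y
    using assms by (auto dest: injD)
  then have *: "independent_set \<lparr>pverts = f ` pverts G, parcs = map_prod f f ` parcs G\<rparr> (f ` T) \<longleftrightarrow>
      independent_set G T" for T
    using assms by (simp add: independent_set_def inj_image_subset_iff)
  show ?thesis
  proof safe
    fix S assume S: "independent_set \<lparr>pverts = f ` pverts G, parcs = map_prod f f ` parcs G\<rparr> S"
    then obtain T where "S = f ` T"
      by (auto simp: independent_set_def subset_image_iff)
    with S show "S \<in> (`) f ` {S. independent_set G S}"
      using * by blast
  qed (use * in blast)
qed

lemma finite_pverts_lex_power: "finite (pverts G) \<Longrightarrow> finite (pverts (lex_power G m))"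
  by (induction m) (auto simp: Let_def lex_prod_def)

text \<open>Subtracting 1 from both sides turns the product formula into plain composition. The
  one-vertex graph has polynomial 1 + z and so matches the identity, the iterate of order 0.\<close>

lemma poly_indep_poly_lex_power:
  assumes fin: "finite (pverts G)"
  shows "poly (indep_poly (lex_power G m)) z = 1 + (poly (indep_poly G - 1) ^^ m) z"
proof (induction m)
  case 0
  have "{S. independent_set (lex_power G 0) S} = {{}, {[]}}"
    by (auto simp: independent_set_def)
  then show ?case
    using poly_indep_poly[of "lex_power G 0" z] by simp
next
  case (Suc m)
  let ?cons = "\<lambda>(x, xs). x # xs" and ?P = "lex_prod G (lex_power G m)"
  have inj: "inj ?cons"
    by (auto simp: inj_def)
  have "poly (indep_poly (lex_power G (Suc m))) z =
      (\<Sum>S | independent_set (lex_power G (Suc m)) S. z ^ card S)"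
    by (intro poly_indep_poly finite_pverts_lex_power fin)
  also have "\<dots> = (\<Sum>S\<in>(`) ?cons ` {S. independent_set ?P S}. z ^ card S)"
    by (simp only: lex_power.simps Let_def independent_sets_relabel[OF inj])
  also have "\<dots> = (\<Sum>S | independent_set ?P S. z ^ card (?cons ` S))"
    by (subst sum.reindex) (auto intro: inj_on_subset[OF inj_on_image] simp: inj inj_image_eq_iff inj_on_def)
  also have "\<dots> = (\<Sum>S | independent_set ?P S. z ^ card S)"
    by (simp only: card_image[OF inj_on_subset[OF inj subset_UNIV]])
  also have "\<dots> = (\<Sum>T | independent_set G T. (poly (indep_poly (lex_power G m)) z - 1) ^ card T)"
    by (simp add: sum_independent_sets_lex_prod fin finite_pverts_lex_power poly_indep_poly)
  also have "\<dots> = poly (indep_poly G) (poly (indep_poly (lex_power G m)) z - 1)"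
    by (simp add: poly_indep_poly fin)
  finally show ?case
    by (simp add: Suc.IH)
qed

lemma Roots_indep_poly_lex_power:
  assumes "finite (pverts G)"
  shows "Roots (indep_poly (lex_power G m)) = {z. (poly (indep_poly G - 1) ^^ m) z = - 1}"
  using assms by (auto simp: Roots_def poly_indep_poly_lex_power add_eq_0_iff)

section \<open>Graphs with one independent triple\<close>

text \<open>The complement consists of the triangle \<open>012\<close>, of \<open>a - 3\<close> further edges at the vertex \<open>0\<close>
  and of isolated vertices, so that \<open>(a\<^sub>1, a\<^sub>2, a\<^sub>3) = (b, a, 1)\<close>.\<close>

definition tri_star :: "nat \<Rightarrow> nat \<Rightarrow> nat pair_pre_digraph" where
  "tri_star a b = \<lparr> pverts = {..<b},
     parcs = {(u, v). u < b \<and> v < b \<and> u \<noteq> v \<and>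
       \<not> (u = 0 \<and> v < a \<or> v = 0 \<and> u < a \<or> {u, v} = {1, 2})} \<rparr>"

lemma finite_pverts_tri_star: "finite (pverts (tri_star a b))"
  by (simp add: tri_star_def)

lemma pair_graph_tri_star: "pair_graph (tri_star a b)"
proof unfold_locales
  show "finite (parcs (tri_star a b))"
    by (rule finite_subset[of _ "{..<b} \<times> {..<b}"]) (auto simp: tri_star_def)
  show "symmetric (with_proj (tri_star a b))"
    by (auto simp: symmetric_def arcs_ends_def arc_to_ends_def tri_star_def sym_def doubleton_eq_iff
      intro!: symI)
qed (auto simp: tri_star_def)

text \<open>These are the cliques of the complement. Two distinct nonzero vertices of a clique can
  only be 1 and 2, so removing 0 leaves at most one vertex or \<open>{1, 2}\<close>.\<close>

lemma independent_set_tri_star_iff: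
  assumes "3 \<le> a" "a \<le> b"
  shows "independent_set (tri_star a b) S \<longleftrightarrow>
    S = {} \<or> (\<exists>v<b. S = {v}) \<or> (\<exists>v\<in>{1..<a}. S = {0, v}) \<or> S = {1, 2} \<or> S = {0, 1, 2}"
    (is "_ \<longleftrightarrow> ?F")
proof
  assume "independent_set (tri_star a b) S"
  then have S: "S \<subseteq> {..<b}"
    and adj: "\<And>u v. u \<in> S \<Longrightarrow> v \<in> S \<Longrightarrow> u \<noteq> v \<Longrightarrow>
      u = 0 \<and> v < a \<or> v = 0 \<and> u < a \<or> u = 1 \<and> v = 2 \<or> u = 2 \<and> v = 1"
    by (auto simp: independent_set_def tri_star_def doubleton_eq_iff subset_iff)
  have off: "S - {0} = {} \<or> (\<exists>v. S - {0} = {v}) \<or> S - {0} = {1, 2}"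
  proof (rule ccontr)
    assume neg: "\<not> ?thesis"
    then obtain u where u: "u \<in> S - {0}"
      by blast
    with neg obtain v where v: "v \<in> S - {0}" "v \<noteq> u"
      by blast
    have "{u, v} = {1, 2}"
      using adj[of u v] u v by auto
    moreover have "S - {0} \<subseteq> {u, v}"
    proof
      fix w assume "w \<in> S - {0}"
      then show "w \<in> {u, v}"
        using adj[of u w] adj[of v w] u v by auto
    qed
    then have "S - {0} = {u, v}"
      using u v by auto
    ultimately show False
      using neg by metis
  qed
  show ?F
  proof (cases "0 \<in> S")
    case True
    consider "S - {0} = {}" | v where "S - {0} = {v}" | "S - {0} = {1, 2}"
      using off by blast
    then show ?thesis
    proof cases
      case 1
      then have "S = {0}"
        using True by blast
      moreover have "0 < b"
        using assms by simp
      ultimately show ?thesis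
        by blast
    next
      case (2 v)
      have "v \<in> S - {0}"
        unfolding 2 by simp
      moreover have v: "S = {0, v}"
        using 2 True by (metis insert_Diff)
      ultimately have "v \<in> {1..<a}"
        using adj[of 0 v] by auto
      with v show ?thesis
        by blast
    next
      case 3
      then have "S = {0, 1, 2}"
        using True by (metis insert_Diff)
      then show ?thesis
        by blast
    qed
  next
    case False
    then have "S - {0} = S"
      by blast
    with off consider "S = {}" | v where "S = {v}" | "S = {1, 2}"
      by auto
    then show ?thesis
      using S by cases blast+
  qed
next
  assume ?F
  then show "independent_set (tri_star a b) S"
    using assms by (elim disjE exE bexE)
      (auto simp: independent_set_def tri_star_def doubleton_eq_iff)
qed

lemma independent_sets_tri_star:
  assumes "3 \<le> a" "a \<le> b"
  shows "{S. independent_set (tri_star a b) S} =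
    {{}} \<union> (\<lambda>v. {v}) ` {..<b} \<union> (\<lambda>v. {0, v}) ` {1..<a} \<union> {{1, 2}, {0, 1, 2}}"
  unfolding independent_set_tri_star_iff[OF assms] by blast

lemma indep_number_tri_star:
  assumes "3 \<le> a" "a \<le> b"
  shows "indep_number (tri_star a b) = 3"
  unfolding indep_number_def
proof (rule Max_eqI)
  show "finite (card ` {S. independent_set (tri_star a b) S})"
    by (simp add: independent_sets_tri_star[OF assms])
  show "3 \<in> card ` {S. independent_set (tri_star a b) S}"
    by (rule image_eqI[of _ _ "{0, 1, 2}"])
       (simp_all add: independent_sets_tri_star[OF assms] del: mem_Collect_eq)
qed (auto simp: independent_sets_tri_star[OF assms] card_insert_if simp del: mem_Collect_eq)

lemma indep_count_tri_star:
  assumes "3 \<le> a" "a \<le> b"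
  shows "indep_count (tri_star a b) 1 = b"
    and "indep_count (tri_star a b) 2 = a"
    and "indep_count (tri_star a b) 3 = 1"
proof -
  let ?I = "{S. independent_set (tri_star a b) S}"
  have eq: "indep_count (tri_star a b) i = card {S \<in> ?I. card S = i}" for i
    by (simp add: indep_count_def)
  have "{S \<in> ?I. card S = 1} = (\<lambda>v. {v}) ` {..<b}"
    unfolding independent_sets_tri_star[OF assms] by auto
  then show "indep_count (tri_star a b) 1 = b"
    by (simp add: eq card_image)
  \<comment> \<open>In the complement, the star at 0 has \<open>a - 1\<close> edges, two sides of
    the triangle among them; the third side \<open>{1, 2}\<close> completes the count to
    \<open>a\<close>.\<close>
  have "{S \<in> ?I. card S = 2} = insert {1, 2} ((\<lambda>v. {0, v}) ` {1..<a})"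
    unfolding independent_sets_tri_star[OF assms] by auto
  moreover have "card ((\<lambda>v. {0, v}) ` {1..<a}) = a - 1"
    by (subst card_image) (auto simp: inj_on_def doubleton_eq_iff)
  moreover have "{1, 2} \<notin> (\<lambda>v. {0, v}) ` {1..<a}"
  proof
    assume "{1, 2} \<in> (\<lambda>v. {0, v}) ` {1..<a}"
    then have "0 \<in> {1, 2 :: nat}"
      by (elim imageE) (simp only: insertI1)
    then show False
      by simp
  qed
  ultimately show "indep_count (tri_star a b) 2 = a"
    using assms by (simp add: eq)
  have "{S \<in> ?I. card S = 3} = {{0, 1, 2}}"
    unfolding independent_sets_tri_star[OF assms] by (auto simp: card_insert_if)
  then show "indep_count (tri_star a b) 3 = 1"
    by (simp add: eq)
qed

section \<open>Cubic polynomials\<close>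

text \<open>After factoring out \<open>w\<close>, the quadratic factor has modulus at least |w|^2 -
  3|w| - 3, which exceeds 1 once |w| > 4. This is the source of the radius \<open>4 * k\<close>
  below.\<close>

lemma cubic_gt_outside:
  fixes w :: complex and s t :: real
  assumes "\<bar>s\<bar> \<le> 3" "\<bar>t\<bar> \<le> 3" "4 < cmod w"
  shows "4 < cmod (w ^ 3 + s * w\<^sup>2 + t * w)"
proof -
  have "cmod w ^ 2 - 3 * cmod w - 3 \<ge> 1"
    using mult_right_mono[of 4 "cmod w" "cmod w"] assms(3) unfolding power2_eq_square by linarith
  also have "cmod w ^ 2 \<le> cmod (w\<^sup>2 + s * w + t) + cmod (s * w + t)"
    using norm_triangle_ineq4[of "w\<^sup>2 + s * w + t" "s * w + t"] by (simp add: norm_power)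
  also have "cmod (s * w + t) \<le> 3 * cmod w + 3"
  proof (rule norm_triangle_le, rule add_mono)
    show "cmod (s * w) \<le> 3 * cmod w"
      unfolding norm_mult using assms(1) by (intro mult_right_mono) auto
  qed (use assms(2) in auto)
  finally have "1 \<le> cmod (w\<^sup>2 + s * w + t)"
    by simp
  then have "4 * 1 < cmod w * cmod (w\<^sup>2 + s * w + t)"
    using assms(3) by (intro mult_less_le_imp_less) auto
  also have "\<dots> = cmod (w ^ 3 + s * w\<^sup>2 + t * w)"
    by (simp add: algebra_simps power2_eq_square power3_eq_cube flip: norm_mult)
  finally show ?thesis
    by simp
qed

text \<open>Quantifies that \<open>Q\<close> and \<open>Q'\<close> have no common root: \<open>E1\<close> and \<open>E2\<close> in the proof are remainders of
  the Euclidean algorithm, which ends with \<open>3 s t\<^sup>2 (s\<^sup>2 - 4 t)\<close>, a multiple of the discriminant.\<close>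

lemma cubic_deriv_gt:
  fixes w :: complex and s t e :: real
  assumes s: "1 \<le> s" "s \<le> 3" and t: "1 \<le> t" "t \<le> 3" and discr: "1 \<le> \<bar>s\<^sup>2 - 4 * t\<bar>"
    and w: "cmod w \<le> 4" and e: "e \<le> 1 / 4000"
    and small: "cmod (w ^ 3 + s * w\<^sup>2 + t * w) \<le> e"
  shows "e < cmod (3 * w\<^sup>2 + 2 * s * w + t)"
proof (rule ccontr)
  define Q D where "Q = w ^ 3 + s * w\<^sup>2 + t * w" and "D = 3 * w\<^sup>2 + 2 * s * w + t"
  define d g where "d = s\<^sup>2 - 4 * t" and "g = 2 * s\<^sup>2 - 6 * t"
  define E1 E2 where "E1 = s * w\<^sup>2 + 2 * t * w" and "E2 = g * w + s * t"
  assume "\<not> ?thesis"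
  then have QD: "cmod Q \<le> e" "cmod D \<le> e"
    using small by (auto simp: Q_def D_def)
  have e0: "0 \<le> e"
    using QD(1) norm_ge_zero order.trans by blast
  have s2: "1 \<le> s\<^sup>2" "s\<^sup>2 \<le> 9"
    using s power_mono[of 1 s 2] power_mono[of s 3 2] by auto
  have d: "\<bar>d\<bar> \<le> 11" and g: "\<bar>g\<bar> \<le> 16"
    using s2 t by (auto simp: d_def g_def)
  have "E1 = 3 * Q - w * D"
    by (simp add: E1_def Q_def D_def algebra_simps power2_eq_square power3_eq_cube)
  also have "cmod \<dots> \<le> 3 * e + 4 * e"
    using QD w e0 by (intro order.trans[OF norm_triangle_ineq4] add_mono)
      (auto simp: norm_mult intro!: mult_mono)
  finally have E1: "cmod E1 \<le> 7 * e"
    by simp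
  have "E2 = s * D - 3 * E1"
    by (simp add: E2_def E1_def D_def g_def algebra_simps power2_eq_square)
  also have "cmod \<dots> \<le> 3 * e + 3 * (7 * e)"
    using QD E1 s e0 by (intro order.trans[OF norm_triangle_ineq4] add_mono)
      (auto simp: norm_mult intro!: mult_mono)
  finally have E2: "cmod E2 \<le> 24 * e"
    by simp
  \<comment> \<open>Since 2g - s^2 = 3d, the bracket \<open>g * E1 - s * w * E2\<close> collapses to
    \<open>3 * t * d * w\<close>. This eliminates \<open>w\<close> without dividing by
    \<open>g\<close>, which vanishes for s = t = 3.\<close>
  have "complex_of_real (3 * s * t\<^sup>2 * d) = (3 * t * d) * E2 - g * (g * E1 - s * w * E2)"
    by (simp add: E1_def E2_def d_def g_def algebra_simps power2_eq_square)
  also have "cmod \<dots> \<le> (3 * 3 * 11) * (24 * e) + 16 * (16 * (7 * e) + (3 * 4) * (24 * e))"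
  proof (intro order.trans[OF norm_triangle_ineq4] add_mono)
    show "cmod ((3 * t * d) * E2) \<le> (3 * 3 * 11) * (24 * e)"
      unfolding norm_mult norm_of_real abs_mult using E2 t d e0 by (intro mult_mono) auto
    have "cmod (g * E1) \<le> 16 * (7 * e)" "cmod (s * w * E2) \<le> (3 * 4) * (24 * e)"
      unfolding norm_mult using E1 E2 s g w e0 by (intro mult_mono; auto)+
    then have "cmod (g * E1 - s * w * E2) \<le> 16 * (7 * e) + (3 * 4) * (24 * e)"
      by (intro order.trans[OF norm_triangle_ineq4] add_mono)
    then show "cmod (g * (g * E1 - s * w * E2)) \<le> 16 * (16 * (7 * e) + (3 * 4) * (24 * e))"
      unfolding norm_mult using g by (intro mult_mono) auto
  qed
  \<comment> \<open>The total coefficient of \<open>e\<close> is 8776, and 8776 / 4000 < 3.\<close>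
  also have "\<dots> < 3"
    using e by simp
  finally have "\<bar>3 * s * t\<^sup>2 * d\<bar> < 3"
    by (simp only: norm_of_real)
  moreover have "1 * 1 * 1 \<le> s * t\<^sup>2 * \<bar>d\<bar>"
    using s t discr by (intro mult_mono) (auto simp: d_def)
  ultimately show False
    using s by (simp add: abs_mult)
qed

text \<open>With z = k w the polynomial becomes k^3 Q(w) and its derivative k^2 Q'(w). The bound on
  \<open>k\<close> gives \<open>k\<^sup>2\<close> at least 40000, which makes 6 / k^2 an admissible
  \<open>e\<close> in \<open>cubic_deriv_gt\<close>.\<close>

lemma expanding_poly_scaled_cubic:
  fixes s t k :: real
  assumes s: "1 \<le> s" "s \<le> 3" and t: "1 \<le> t" "t \<le> 3" and discr: "1 \<le> \<bar>s\<^sup>2 - 4 * t\<bar>"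
    and k: "200 \<le> k"
  shows "expanding_poly [:0, of_real (t * k\<^sup>2), of_real (s * k), 1:] (4 * k)"
proof -
  define p :: "complex poly" where "p = [:0, of_real (t * k\<^sup>2), of_real (s * k), 1:]"
  define Q where "Q w = w ^ 3 + s * w\<^sup>2 + t * w" for w :: complex
  define D where "D w = 3 * w\<^sup>2 + of_real (2 * s) * w + t" for w :: complex
  have "k \<noteq> 0"
    using k by simp
  have p_scaled: "poly p (k * w) = of_real (k ^ 3) * Q w" for w :: complex
    by (simp add: p_def Q_def algebra_simps power2_eq_square power3_eq_cube)
  have p: "cmod (poly p z) = k ^ 3 * cmod (Q (z / k))" for z
    using p_scaled[of "z / k"] \<open>k \<noteq> 0\<close> k by (simp add: norm_mult norm_power)
  have p'_scaled: "poly (pderiv p) (k * w) = of_real (k\<^sup>2) * D w" for w :: complex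
    by (simp add: p_def D_def pderiv_pCons algebra_simps power2_eq_square)
  have p': "cmod (poly (pderiv p) z) = k\<^sup>2 * cmod (D (z / k))" for z
    using p'_scaled[of "z / k"] \<open>k \<noteq> 0\<close> by (simp add: norm_mult norm_power)
  have k2: "40000 \<le> k\<^sup>2"
    using power_mono[OF k, of 2] by simp
  have bound: "cmod z \<le> 4 * k" if "cmod (poly p z) \<le> 4 * k" for z
  proof (rule ccontr)
    assume "\<not> ?thesis"
    then have "4 < cmod (z / k)"
      using k by (simp add: norm_divide pos_less_divide_eq)
    then have "4 < cmod (Q (z / k))"
      unfolding Q_def using s t by (intro cubic_gt_outside) auto
    then have "k ^ 3 * 4 < cmod (poly p z)"
      using k by (simp add: p)
    moreover have "k * 1 \<le> k * k\<^sup>2"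
      using k k2 by (intro mult_left_mono) auto
    ultimately show False
      using that by (simp add: power3_eq_cube power2_eq_square)
  qed
  have deriv: "6 \<le> cmod (poly (pderiv p) z)" if z: "cmod (poly p z) \<le> 4 * k" for z
  proof -
    have "cmod (z / k) \<le> 4"
      using bound[OF z] k by (simp add: norm_divide pos_divide_le_eq)
    \<comment> \<open>The hypothesis even gives 4 / k^2. The weaker 6 / k^2 is used because the same
      \<open>e\<close> must bound Q' from below, where 6 is twice the degree.\<close>
    moreover have "cmod (Q (z / k)) \<le> 6 / k\<^sup>2"
    proof -
      have "k * (k\<^sup>2 * cmod (Q (z / k))) \<le> k * 4"
        using z by (simp add: p power3_eq_cube power2_eq_square mult_ac)
      then have "k\<^sup>2 * cmod (Q (z / k)) \<le> 4"
        using k by simp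
      then show ?thesis
        using \<open>k \<noteq> 0\<close> by (simp add: pos_le_divide_eq mult.commute)
    qed
    moreover have "6 / k\<^sup>2 \<le> 1 / 4000"
      using k2 by (simp add: divide_le_eq)
    ultimately have "6 / k\<^sup>2 < cmod (D (z / k))"
      unfolding Q_def D_def using s t discr by (intro cubic_deriv_gt)
    then show ?thesis
      using \<open>k \<noteq> 0\<close> by (simp add: p' pos_divide_less_eq mult.commute)
  qed
  have "degree p = 3"
    by (simp add: p_def)
  have "expanding_poly p (4 * k)"
  proof unfold_locales
    show "cmod z \<le> 4 * k" if "cmod (poly p z) \<le> 4 * k" for z
      by (rule bound[OF that])
    show "2 * degree p \<le> cmod (poly (pderiv p) z)" if "cmod (poly p z) \<le> 4 * k" for z
      using deriv[OF that] \<open>degree p = 3\<close> by simp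
  qed (use k in \<open>simp_all add: p_def\<close>)
  then show ?thesis
    by (simp add: p_def)
qed

section \<open>Attractors of the graph families and growth of their diameters\<close>

lemma scale_bounds:
  fixes s t k :: nat
  assumes "1 \<le> s" "s \<le> 3" "1 \<le> t" "3 \<le> k"
  shows "3 \<le> s * k" "s * k \<le> t * k\<^sup>2"
proof -
  show "3 \<le> s * k"
    using mult_le_mono[of 1 s 3 k] assms by simp
  have "s \<le> t * k"
    using mult_le_mono[of 1 t 3 k] assms by linarith
  then show "s * k \<le> t * k\<^sup>2"
    unfolding power2_eq_square mult.assoc[symmetric] by (rule mult_le_mono1)
qed

text \<open>The attractor is the filled Julia set of the cubic. It contains 0 and a root of the
  quadratic factor, and their distance bounds the diameter from below.\<close>

lemma independence_attractor_tri_star: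
  fixes s t k :: nat
  assumes s: "1 \<le> s" "s \<le> 3" and t: "1 \<le> t" "t \<le> 3" and discr: "s\<^sup>2 \<noteq> 4 * t"
    and k: "200 \<le> k"
  obtains A where "has_independence_attractor (tri_star (s * k) (t * k\<^sup>2)) A" "k / 4 \<le> diameter A"
proof -
  let ?G = "tri_star (s * k) (t * k\<^sup>2)"
  define p :: "complex poly" where "p = [:0, of_nat (t * k\<^sup>2), of_nat (s * k), 1:]"
  have "3 \<le> s * k" "s * k \<le> t * k\<^sup>2"
    using scale_bounds[of s t k] s t k by auto
  then have p: "indep_poly ?G - 1 = p"
    by (simp add: indep_poly_indep_number_3 pair_graph_tri_star indep_number_tri_star
        indep_count_tri_star p_def one_pCons del: One_nat_def)
  \<comment> \<open>A nonzero integer has modulus at least 1, as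
    \<open>expanding_poly_scaled_cubic\<close> requires.\<close>
  have "1 \<le> \<bar>int (s\<^sup>2) - int (4 * t)\<bar>"
    using discr by linarith
  then have "real_of_int 1 \<le> real_of_int \<bar>int (s\<^sup>2) - int (4 * t)\<bar>"
    by (simp only: of_int_le_iff)
  then have "expanding_poly [:0, of_real (real t * (real k)\<^sup>2), of_real (real s * real k), 1:] (4 * real k)"
    using s t k by (intro expanding_poly_scaled_cubic) auto
  then interpret expanding_poly p "4 * real k"
    by (simp add: p_def)
  have "has_independence_attractor ?G filled_julia"
    unfolding has_independence_attractor_def Roots_indep_poly_lex_power[OF finite_pverts_tri_star] p
    using k by (intro hausdorff_limit_preimages) simp
  moreover have "k / 4 \<le> diameter filled_julia"
  proof -
    let ?q = "[:of_nat (t * k\<^sup>2), of_nat (s * k), 1:] :: complex poly"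
    obtain z where z: "poly ?q z = 0"
      using alg_closed_imp_poly_has_root[of ?q] by auto
    then have "poly p z = 0"
      by (simp add: p_def)
    then have "z \<in> filled_julia"
      using iterate_0_in_filled_julia[of 1 z] by simp
    moreover have "0 \<in> filled_julia"
      using iterate_0_in_filled_julia[of 0 0] by simp
    ultimately have "dist z 0 \<le> diameter filled_julia"
      by (intro diameter_bounded_bound compact_imp_bounded compact_filled_julia)
    moreover have "k / 4 \<le> cmod z"
    proof (rule ccontr)
      assume "\<not> ?thesis"
      then have less: "cmod z < k / 4"
        by simp
      \<comment> \<open>For |z| < k/4 the right-hand side has modulus at most (1/4)(13/4) k^2 =
        (13/16) k^2, too small for the left-hand side since t is at least 1.\<close>
      have "complex_of_real (t * k\<^sup>2) = - (z * (z + of_nat (s * k)))"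
        using z by (simp add: algebra_simps eq_neg_iff_add_eq_0)
      then have "t * k\<^sup>2 = cmod (z * (z + of_nat (s * k)))"
        by (metis norm_minus_cancel norm_of_real abs_of_nat)
      also have "\<dots> \<le> cmod z * (cmod z + s * k)"
        unfolding norm_mult
        by (intro mult_left_mono order.trans[OF norm_triangle_ineq] add_mono)
          (simp_all add: norm_mult)
      also have "\<dots> \<le> k / 4 * (k / 4 + 3 * k)"
        using less s by (intro mult_mono add_mono) (auto simp del: of_nat_mult intro!: mult_right_mono)
      also have "\<dots> < k * k"
        using k by simp
      also have "\<dots> \<le> t * (k * k)"
        using t mult_right_mono[of 1 "real t" "real k * real k"] by simp
      finally show False
        by (simp add: power2_eq_square)
    qed
    ultimately show ?thesis
      by simp
  qed
  ultimately show ?thesis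
    by (rule that)
qed

theorem theorem1p6:
  shows "\<exists>G1 G2 G3 :: nat \<Rightarrow> nat pair_pre_digraph.
    (\<forall>n>0. \<forall>G\<in>{G1 n, G2 n, G3 n}.
       pair_graph G \<and> indep_number G = 3 \<and> (\<exists>A. has_independence_attractor G A)) \<and>
    (\<forall>n>0. (indep_count (G1 n) 2)^2 < 3 * indep_count (G1 n) 1 * indep_count (G1 n) 3) \<and>
    (\<forall>n>0. (indep_count (G2 n) 2)^2 = 3 * indep_count (G2 n) 1 * indep_count (G2 n) 3) \<and>
    (\<forall>n>0. (indep_count (G3 n) 2)^2 > 3 * indep_count (G3 n) 1 * indep_count (G3 n) 3) \<and>
    (\<forall>F\<in>{G1, G2, G3}.
       filterlim (\<lambda>n. diameter (independence_attractor (F n))) at_top sequentially)"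
proof -
  \<comment> \<open>The shift by 200 meets the bound on \<open>k\<close> for every
    \<open>n\<close>.\<close>
  define F where "F s t n = tri_star (s * (n + 200)) (t * (n + 200)\<^sup>2)" for s t n :: nat
  have graph: "pair_graph (F s t n)" and number: "indep_number (F s t n) = 3"
    and count: "indep_count (F s t n) 1 = t * (n + 200)\<^sup>2" "indep_count (F s t n) 2 = s * (n + 200)"
      "indep_count (F s t n) 3 = 1"
    if "1 \<le> s" "s \<le> 3" "1 \<le> t" for s t n
    unfolding F_def using that scale_bounds[of s t "n + 200"]
    by (simp_all add: pair_graph_tri_star indep_number_tri_star indep_count_tri_star del: One_nat_def)
  have attractor: "\<exists>A. has_independence_attractor (F s t n) A"
      and lim: "filterlim (\<lambda>n. diameter (independence_attractor (F s t n))) at_top sequentially"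
    if st: "1 \<le> s" "s \<le> 3" "1 \<le> t" "t \<le> 3" "s\<^sup>2 \<noteq> 4 * t" for s t n
  proof -
    have ex: "\<exists>A. has_independence_attractor (F s t n) A \<and> real (n + 200) / 4 \<le> diameter A" for n
      unfolding F_def by (rule independence_attractor_tri_star[OF st, of "n + 200"]) auto
    then show "\<exists>A. has_independence_attractor (F s t n) A"
      by blast
    have "1 / 4 * real n \<le> diameter (independence_attractor (F s t n))" for n
      using ex[of n] by (auto simp: independence_attractor_eq)
    then have "\<forall>\<^sub>F n in sequentially. 1 / 4 * real n \<le> diameter (independence_attractor (F s t n))"
      by (intro always_eventually allI)
    moreover have "filterlim (\<lambda>n. 1 / 4 * real n) at_top sequentially"
      by (rule filterlim_tendsto_pos_mult_at_top[OF tendsto_const _ filterlim_real_sequentially]) simp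
    ultimately show "filterlim (\<lambda>n. diameter (independence_attractor (F s t n))) at_top sequentially"
      by (rule filterlim_at_top_mono[rotated])
  qed
  show ?thesis
  \<comment> \<open>After cancelling (n + 200)^2 the three relations compare s^2 with 3t: 1 < 3, 9 =
    9 and 9 > 6. The values of s^2 - 4t are -3, -3 and 1, all nonzero.\<close>
  proof (rule exI[of _ "F 1 1"], rule exI[of _ "F 3 3"], rule exI[of _ "F 3 2"], intro conjI)
    show "\<forall>n>0. \<forall>G\<in>{F 1 1 n, F 3 3 n, F 3 2 n}.
        pair_graph G \<and> indep_number G = 3 \<and> (\<exists>A. has_independence_attractor G A)"
      using graph number attractor by simp
    show "\<forall>H\<in>{F 1 1, F 3 3, F 3 2}.
        filterlim (\<lambda>n. diameter (independence_attractor (H n))) at_top sequentially"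
      using lim by simp
  qed (simp_all add: count power_mult_distrib del: One_nat_def distrib_left_numeral)
qed

end
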